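(* For $n\in\mathbb{N}$ and $|x|<1$, the second moment of the Meyer-König and Zeller operator $M_n$ has the representation $$ (M_n e_2)(x)=(-1)^n\frac{n(1-x)^{n+1}}{x^n}\log(1-x)+2x-1+n(1-x)\sum_{k=1}^{n-1}(-1)^{n-1-k}\frac{1}{k}\left(\frac{1-x}{x}\right)^{n-k}. $$
   Context: Here $\mathbb{N}=\{1,2,3,\ldots\}$. For $n\in\mathbb{N}$, the Meyer-König and Zeller (MKZ) operator $M_n$ is defined by $$ (M_n f)(x)=(1-x)^{n+1}\sum_{\nu=0}^{\infty}\binom{\nu+n}{\nu}f\left(\frac{\nu}{\nu+n}\right)x^{\nu}. $$ $e_2$ denotes the monomial $e_2(t)=t^2$, so the second moment is $$(M_n e_2)(x)=(1-x)^{n+1}\sum_{\nu=0}^{\infty}\binom{\nu+n}{\nu}\left(\frac{\nu}{\nu+n}\right)^{2}x^{\nu},$$ a series that converges for $|x|<1$. $\log$ is the natural logarithm, and for $n=1$ the sum over $k$ is empty (equal to $0$). *)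

theory Defs
  imports Complex_Main
begin

definition MKZ :: "nat \<Rightarrow> (real \<Rightarrow> real) \<Rightarrow> real \<Rightarrow> real" where
  "MKZ n f x = (1 - x) ^ (n + 1) *
     (\<Sum>\<nu>. real ((\<nu> + n) choose \<nu>) * f (real \<nu> / real (\<nu> + n)) * x ^ \<nu>)"

text \<open>Since \<open>suminf\<close> is total, we record that the series converges for the functions
  and arguments of interest.\<close>

lemma MKZ_summable:
  fixes x :: real
  assumes x: "\<bar>x\<bar> < 1" and f: "\<And>t. 0 \<le> t \<Longrightarrow> t \<le> 1 \<Longrightarrow> \<bar>f t\<bar> \<le> B"
  shows "summable (\<lambda>\<nu>. real ((\<nu> + n) choose \<nu>) * f (real \<nu> / real (\<nu> + n)) * x ^ \<nu>)"
proof -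
  define a where "a = (\<lambda>\<nu>. real ((\<nu> + n) choose \<nu>) * \<bar>x\<bar> ^ \<nu>)"
  have "summable a"
  proof -
    obtain c where c: "\<bar>x\<bar> < c" "c < 1" using x dense by blast
    obtain N :: nat where N: "real n * \<bar>x\<bar> / (c - \<bar>x\<bar>) < real N"
      using reals_Archimedean2 by blast
    show ?thesis
    proof (rule summable_ratio_test[OF c(2)])
      fix k assume k: "N \<le> k"
      have "real n * \<bar>x\<bar> < real k * (c - \<bar>x\<bar>)"
        using N k c by (simp add: pos_divide_less_eq)
          (smt (verit) mult_right_mono of_nat_le_iff)
      then have le: "real (k + 1 + n) * \<bar>x\<bar> \<le> c * real (k + 1)"
        using c by (simp add: algebra_simps)
      have "(Suc k) * ((Suc k + n) choose Suc k) = (Suc k + n) * ((k + n) choose k)"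
        using Suc_times_binomial_eq[of "k + n" k] by (simp add: mult.commute)
      then have e: "real (Suc k) * real ((Suc k + n) choose Suc k)
          = real (k + 1 + n) * real ((k + n) choose k)"
        by (metis Suc_eq_plus1 of_nat_mult)
      have "real (Suc k) * a (Suc k) = (real (k + 1 + n) * \<bar>x\<bar>) * a k"
        unfolding a_def power_Suc using e by (metis (no_types, lifting) mult.assoc mult.left_commute)
      also have "\<dots> \<le> (c * real (k + 1)) * a k"
        by (rule mult_right_mono[OF le]) (simp add: a_def)
      finally have "real (Suc k) * a (Suc k) \<le> real (Suc k) * (c * a k)"
        by (simp add: mult_ac)
      then have "a (Suc k) \<le> c * a k" by (simp del: of_nat_Suc)
      then show "norm (a (Suc k)) \<le> c * norm (a k)" by (simp add: a_def)
    qed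
  qed
  then have s: "summable (\<lambda>\<nu>. B * a \<nu>)" by (rule summable_mult)
  show ?thesis
  proof (rule summable_comparison_test'[OF s])
    fix k :: nat
    have "\<bar>f (real k / real (k + n))\<bar> \<le> B"
      by (rule f) (auto simp: divide_le_eq)
    then have "a k * \<bar>f (real k / real (k + n))\<bar> \<le> a k * B"
      by (rule mult_left_mono) (simp add: a_def)
    then show "norm (real ((k + n) choose k) * f (real k / real (k + n)) * x ^ k) \<le> B * a k"
      by (simp add: a_def abs_mult power_abs mult_ac)
  qed
qed

end

theory Submission
  imports Defs "HOL-Analysis.Analysis"
begin

text \<open>
  Writing \<open>\<nu>/(\<nu>+n) = 1 - n/(\<nu>+n)\<close> and expanding the square splits the second moment into two
  negative binomial series and the series \<open>\<Sum>\<nu>. binom(\<nu>+n-1, \<nu>) x\<^sup>\<nu>/(\<nu>+n)\<close>. After multiplication by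
  \<open>x\<^sup>n\<close> the latter, as a function of \<open>n\<close>, satisfies by Pascal's rule a first-order recurrence
  that starts with the logarithm series and adds one power of \<open>x/(1-x)\<close> in each step.
  The value at \<open>x = 0\<close> is handled by continuity of power series.
\<close>

text \<open>This is the binomial series at exponent \<open>- real (n + 1)\<close> and argument
  \<open>- x\<close>: upper negation of the generalized coefficient produces a sign that cancels
  against that of \<open>(- x) ^ \<nu>\<close>.\<close>

lemma negative_binomial_sums:
  fixes x :: real
  assumes "\<bar>x\<bar> < 1"
  shows "(\<lambda>\<nu>. real ((\<nu> + n) choose \<nu>) * x ^ \<nu>) sums (1 / (1 - x) ^ (n + 1))"
proof -
  have "((- real (n + 1)) gchoose \<nu>) * (- x) ^ \<nu> = real ((\<nu> + n) choose \<nu>) * x ^ \<nu>" for \<nu>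
  proof -
    have "((- real (n + 1)) gchoose \<nu>) = (- 1) ^ \<nu> * (real (\<nu> + n) gchoose \<nu>)"
      by (subst gbinomial_minus) (simp add: algebra_simps)
    then show ?thesis
      by (simp add: binomial_gbinomial power_mult_distrib[of "- 1" "- x", simplified])
  qed
  moreover have "(1 - x) powr (- real (n + 1)) = 1 / (1 - x) ^ (n + 1)"
    using assms by (simp only: powr_minus) (subst powr_realpow, auto simp: divide_inverse)
  ultimately show ?thesis
    using gen_binomial_real[of "- x" "- real (n + 1)"] assms by simp
qed

text \<open>The series is the antiderivative of \<open>x ^ m / (1 - x) ^ (m + 1)\<close> vanishing
  at 0. The exponent \<open>\<nu> + m + 1\<close> keeps the recurrence in \<open>m\<close> free of
  correcting powers of \<open>x\<close>.\<close>

lemma binomial_quotient_sums: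
  fixes x :: real
  assumes "\<bar>x\<bar> < 1"
  shows "(\<lambda>\<nu>. real ((\<nu> + m) choose \<nu>) * x ^ (\<nu> + m + 1) / real (\<nu> + m + 1)) sums
    ((-1) ^ (m + 1) * ln (1 - x) + (\<Sum>k = 1..m. (-1) ^ (m - k) * (1 / real k) * (x / (1 - x)) ^ k))"
proof (induction m)
  case 0
  have "(\<lambda>\<nu>. - (x ^ \<nu>) / real \<nu>) sums ln (1 - x)"
    using ln_series'[of "- x"] assms by simp
  \<comment> \<open>Division by \<open>real 0\<close> yields 0, so dropping the term at index 0
    leaves the sum unchanged.\<close>
  then have "(\<lambda>\<nu>. - (x ^ Suc \<nu>) / real (Suc \<nu>)) sums ln (1 - x)"
    by (subst sums_Suc_iff) simp
  from sums_minus[OF this] show ?case by simp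
next
  case (Suc m)
  let ?T = "\<lambda>m \<nu>. real ((\<nu> + m) choose \<nu>) * x ^ (\<nu> + m + 1) / real (\<nu> + m + 1)"
  let ?L = "\<lambda>m. (-1) ^ (m + 1) * ln (1 - x)
      + (\<Sum>k = 1..m. (-1) ^ (m - k) * (1 / real k) * (x / (1 - x)) ^ k)"
  let ?D = "\<lambda>\<nu>. x ^ (m + 1) / real (m + 1) * (real ((\<nu> + m) choose \<nu>) * x ^ \<nu>) - ?T m \<nu>"
  have D: "?D sums (x ^ (m + 1) / real (m + 1) * (1 / (1 - x) ^ (m + 1)) - ?L m)"
    by (intro sums_diff sums_mult negative_binomial_sums assms Suc.IH)
  \<comment> \<open>Absorption relates the two binomials by the factor
    \<open>(\<nu> + 1) / (m + 1)\<close>; writing \<open>\<nu> + 1\<close> as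
    \<open>(\<nu> + m + 2) - (m + 1)\<close> splits the quotient into the two terms of
    \<open>?D\<close>.\<close>
  have T: "?T (Suc m) \<nu> = ?D (Suc \<nu>)" for \<nu>
  proof -
    define c where "c = real ((Suc \<nu> + m) choose Suc \<nu>)"
    define d where "d = real ((\<nu> + Suc m) choose \<nu>)"
    have "Suc \<nu> * ((Suc \<nu> + m) choose Suc \<nu>) = Suc m * ((\<nu> + Suc m) choose \<nu>)"
      using binomial_absorb_comp[of "Suc \<nu> + m" \<nu>] Suc_times_binomial_eq[of "\<nu> + m" \<nu>]
      by (simp add: mult.commute)
    then have "real (Suc \<nu>) * c = real (Suc m) * d"
      unfolding c_def d_def by (metis of_nat_mult)
    then have "d / real (\<nu> + m + 2) = c / real (m + 1) - c / real (\<nu> + m + 2)"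
      by (simp add: divide_simps) (simp add: algebra_simps)
    then have "d * x ^ (\<nu> + m + 2) / real (\<nu> + m + 2)
        = (c / real (m + 1) - c / real (\<nu> + m + 2)) * x ^ (\<nu> + m + 2)"
      by (metis times_divide_eq_left)
    then show ?thesis
      unfolding c_def[symmetric] d_def[symmetric]
      by (simp add: power_add algebra_simps)
  qed
  \<comment> \<open>The shift costs nothing: both terms of \<open>?D 0\<close> equal
    \<open>x ^ (m + 1) / real (m + 1)\<close>.\<close>
  have "?T (Suc m) sums (x ^ (m + 1) / real (m + 1) * (1 / (1 - x) ^ (m + 1)) - ?L m)"
    unfolding T by (subst sums_Suc_iff) (use D in simp)
  moreover have "(\<Sum>k = 1..m. (-1) ^ (Suc m - k) * (1 / real k) * (x / (1 - x)) ^ k)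
      = - (\<Sum>k = 1..m. (-1) ^ (m - k) * (1 / real k) * (x / (1 - x)) ^ k)"
    unfolding sum_negf[symmetric] by (intro sum.cong) (auto simp: Suc_diff_le)
  then have "x ^ (m + 1) / real (m + 1) * (1 / (1 - x) ^ (m + 1)) - ?L m = ?L (Suc m)"
    by (simp add: power_divide)
  ultimately show ?case by (simp only:)
qed

lemma MKZ_second_moment:
  fixes x :: real
  assumes n: "n \<ge> 1" and x: "\<bar>x\<bar> < 1" "x \<noteq> 0"
  shows "MKZ n (\<lambda>t. t ^ 2) x =
    (-1) ^ n * (real n * (1 - x) ^ (n + 1) / x ^ n) * ln (1 - x) + 2 * x - 1
    + real n * (1 - x) *
      (\<Sum>k = 1..n - 1. (-1) ^ (n - 1 - k) * (1 / real k) * ((1 - x) / x) ^ (n - k))"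
proof -
  obtain m where m: "n = m + 1"
    using n by (metis add.commute le_Suc_ex)
  let ?S = "\<Sum>k = 1..m. (-1) ^ (m - k) * (1 / real k) * (x / (1 - x)) ^ k"
  let ?L = "(-1) ^ n * ln (1 - x) + ?S"
  let ?c = "\<lambda>\<nu>. real ((\<nu> + n) choose \<nu>)" and ?d = "\<lambda>\<nu>. real ((\<nu> + m) choose \<nu>)"
  have "?c \<nu> * (real \<nu> / real (\<nu> + n)) ^ 2 * x ^ \<nu>
      = ?c \<nu> * x ^ \<nu> - 2 * (?d \<nu> * x ^ \<nu>)
        + real n / x ^ n * (?d \<nu> * x ^ (\<nu> + m + 1) / real (\<nu> + m + 1))" for \<nu>
  proof -
    \<comment> \<open>Each factor \<open>n / (\<nu> + n)\<close> next to \<open>?c\<close> turns it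
      into \<open>?d\<close>. This removes the denominator from the mixed term of the square and
      leaves a single one in the last term.\<close>
    have "(\<nu> + n) * ((\<nu> + m) choose \<nu>) = n * ((\<nu> + n) choose \<nu>)"
      using binomial_absorb_comp[of "\<nu> + n" \<nu>] by (simp add: m)
    then have "real (\<nu> + n) * ?d \<nu> = real n * ?c \<nu>"
      by (metis of_nat_mult)
    then have d: "?d \<nu> = real n * ?c \<nu> / real (\<nu> + n)"
      using n by (simp add: field_simps)
    have q: "real \<nu> / real (\<nu> + n) = 1 - real n / real (\<nu> + n)"
      using n by (simp add: field_simps)
    have e: "real n / x ^ n * (a * x ^ (\<nu> + m + 1) / real (\<nu> + m + 1))
        = a * x ^ \<nu> * (real n / real (\<nu> + n))" for a
      using x by (simp add: m power_add)
    show ?thesis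
      unfolding e unfolding d q by (simp add: power2_eq_square algebra_simps)
  qed
  moreover have "(\<lambda>\<nu>. ?c \<nu> * x ^ \<nu> - 2 * (?d \<nu> * x ^ \<nu>)
        + real n / x ^ n * (?d \<nu> * x ^ (\<nu> + m + 1) / real (\<nu> + m + 1))) sums
      (1 / (1 - x) ^ (n + 1) - 2 * (1 / (1 - x) ^ n) + real n / x ^ n * ?L)"
    unfolding m
    by (intro sums_add sums_diff sums_mult negative_binomial_sums binomial_quotient_sums x)
  ultimately have "MKZ n (\<lambda>t. t ^ 2) x
      = (1 - x) ^ (n + 1) * (1 / (1 - x) ^ (n + 1) - 2 * (1 / (1 - x) ^ n) + real n / x ^ n * ?L)"
    unfolding MKZ_def by (simp only: sums_unique[symmetric])
  \<comment> \<open>The first two series contribute \<open>1 - 2 * (1 - x)\<close>, which is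
    \<open>2 * x - 1\<close>.\<close>
  also have "\<dots> = (-1) ^ n * (real n * (1 - x) ^ (n + 1) / x ^ n) * ln (1 - x) + 2 * x - 1
      + real n * (1 - x) * (((1 - x) / x) ^ n * ?S)"
  proof -
    define p where "p = (1 - x) ^ n"
    have "p \<noteq> 0" "(1 - x) ^ (n + 1) = (1 - x) * p" "((1 - x) / x) ^ n = p / x ^ n"
      using x by (auto simp: p_def power_divide)
    then show ?thesis
      using x by (simp only: p_def[symmetric]) (simp add: divide_simps, simp add: algebra_simps)
  qed
  also have "((1 - x) / x) ^ n * ?S
      = (\<Sum>k = 1..n - 1. (-1) ^ (n - 1 - k) * (1 / real k) * ((1 - x) / x) ^ (n - k))"
    unfolding sum_distrib_left
  proof (intro sum.cong)
    fix k assume k: "k \<in> {1..n - 1}"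
    have "((1 - x) / x) ^ n * (x / (1 - x)) ^ k = ((1 - x) / x) ^ (n - k)"
      using k x by (subst power_diff) (auto simp: power_divide)
    then have "(-1) ^ (m - k) * (1 / real k) * (((1 - x) / x) ^ n * (x / (1 - x)) ^ k)
        = (-1) ^ (m - k) * (1 / real k) * ((1 - x) / x) ^ (n - k)"
      by (simp only:)
    then show "((1 - x) / x) ^ n * ((-1) ^ (m - k) * (1 / real k) * (x / (1 - x)) ^ k)
        = (-1) ^ (n - 1 - k) * (1 / real k) * ((1 - x) / x) ^ (n - k)"
      by (simp only: m add_diff_cancel_right' mult_ac)
  qed (simp add: m)
  finally show ?thesis .
qed

text \<open>Convergence at \<open>1 / 2\<close> puts 0 in the interior of the disc of convergence,
  where a power series is continuous.\<close>

lemma isCont_MKZ_0: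
  assumes f: "\<And>t. 0 \<le> t \<Longrightarrow> t \<le> 1 \<Longrightarrow> \<bar>f t\<bar> \<le> B"
  shows "isCont (MKZ n f) 0"
proof -
  have "summable (\<lambda>\<nu>. real ((\<nu> + n) choose \<nu>) * f (real \<nu> / real (\<nu> + n)) * (1 / 2) ^ \<nu>)"
    by (rule MKZ_summable) (use f in auto)
  then have "isCont (\<lambda>x. \<Sum>\<nu>. real ((\<nu> + n) choose \<nu>) * f (real \<nu> / real (\<nu> + n)) * x ^ \<nu>) 0"
    by (rule isCont_powser) simp
  then show ?thesis
    unfolding MKZ_def[abs_def] by (intro continuous_intros)
qed

text \<open>At 0 the singularity of the formula is removable, hence the limit. Plain evaluation
  there would give -1, since division by zero yields 0, whereas the moment is 0.\<close>

theorem corollary2: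
  fixes n :: nat and x :: real
  assumes "n \<ge> 1" and "\<bar>x\<bar> < 1"
  shows "let R = (\<lambda>y::real.
             (-1) ^ n * (real n * (1 - y) ^ (n + 1) / y ^ n) * ln (1 - y) + 2 * y - 1
             + real n * (1 - y) *
               (\<Sum>k = 1..n - 1. (-1) ^ (n - 1 - k) * (1 / real k) * ((1 - y) / y) ^ (n - k)))
         in (x \<noteq> 0 \<longrightarrow> MKZ n (\<lambda>t. t ^ 2) x = R x) \<and>
            (x = 0 \<longrightarrow> (R \<longlongrightarrow> MKZ n (\<lambda>t. t ^ 2) x) (at x))"
  unfolding Let_def
proof (intro conjI impI)
  assume "x \<noteq> 0"
  with assms show "MKZ n (\<lambda>t. t ^ 2) x =
      (-1) ^ n * (real n * (1 - x) ^ (n + 1) / x ^ n) * ln (1 - x) + 2 * x - 1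
      + real n * (1 - x) *
        (\<Sum>k = 1..n - 1. (-1) ^ (n - 1 - k) * (1 / real k) * ((1 - x) / x) ^ (n - k))"
    by (rule MKZ_second_moment)
next
  assume x: "x = 0"
  have "isCont (MKZ n (\<lambda>t. t ^ 2)) 0"
    by (rule isCont_MKZ_0[of _ 1]) (simp add: power_le_one)
  then have "(MKZ n (\<lambda>t. t ^ 2) \<longlongrightarrow> MKZ n (\<lambda>t. t ^ 2) x) (at x)"
    by (simp add: x isCont_def)
  \<comment> \<open>The formula holds on the whole punctured interval of radius 1 around 0, so both
    functions have the same limit.\<close>
  moreover have "eventually (\<lambda>y. MKZ n (\<lambda>t. t ^ 2) y =
      (-1) ^ n * (real n * (1 - y) ^ (n + 1) / y ^ n) * ln (1 - y) + 2 * y - 1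
      + real n * (1 - y) *
        (\<Sum>k = 1..n - 1. (-1) ^ (n - 1 - k) * (1 / real k) * ((1 - y) / y) ^ (n - k))) (at x)"
    unfolding eventually_at
    by (intro exI[of _ 1] conjI ballI impI MKZ_second_moment assms(1))
      (auto simp: x dist_real_def)
  ultimately show "((\<lambda>y. (-1) ^ n * (real n * (1 - y) ^ (n + 1) / y ^ n) * ln (1 - y) + 2 * y - 1
      + real n * (1 - y) *
        (\<Sum>k = 1..n - 1. (-1) ^ (n - 1 - k) * (1 / real k) * ((1 - y) / y) ^ (n - k)))
      \<longlongrightarrow> MKZ n (\<lambda>t. t ^ 2) x) (at x)"
    by (rule Lim_transform_eventually)
qed

end
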